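(* Let $F(z)=|z|^2L(z)+K(z)$ be in the class $L_{Lh}(\mathbb{D})$, where $L$ is logharmonic and $K$ is harmonic in $\mathbb{D}$, and suppose that $F(0)=\lambda_F(0)-1=0$, that $\Lambda_K(z)\le 1$ for all $z\in\mathbb{D}$, and that $\Lambda_L(z)\le\Lambda_2$ for all $z\in\mathbb{D}$, where $\Lambda_2$ is a constant. Then there exists a constant $0<r_1'\le 1$ such that $F$ is univalent in the disk $|z|<r_1'$, where $$r_1'=\begin{cases}1, & \text{if } 3\Lambda_2\le 1,\\ \dfrac{1}{\sqrt{3\Lambda_2}}, & \text{if } 3\Lambda_2>1,\end{cases}$$ and $F(\mathbb{D}_{r_1'})$ contains a schlicht disk $\mathbb{D}_{\rho_1'}$, with $\rho_1'=r_1'-r_1'^3\Lambda_2$. Moreover, these estimates (both $r_1'$ and $\rho_1'$) are sharp, with an extremal function given by $$F_1(z)=z-\Lambda_2z^2\overline z,\quad z\in\mathbb{D}.$$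
   Context: Notation: $\mathbb{D}_r=\{z\in\mathbb{C}:|z|<r\}$ for $r>0$, and $\mathbb{D}=\mathbb{D}_1$. Subscripts $z,\overline z$ denote the Wirtinger derivatives. For a continuously differentiable complex-valued function $f$ set $\Lambda_f(z)=|f_z(z)|+|f_{\overline z}(z)|$ and $\lambda_f(z)=\bigl||f_z(z)|-|f_{\overline z}(z)|\bigr|$. A function $f$ is harmonic if $\Delta f=4\frac{\partial^2 f}{\partial z\,\partial\overline z}=0$. A logharmonic function in $\mathbb{D}$ is a solution $f$ of the nonlinear elliptic equation $\overline{f_{\overline z}}/\overline f=a\,f_z/f$, where $a$ is analytic in $\mathbb{D}$ with $|a(z)|<1$ for $z\in\mathbb{D}$. $L_{Lh}(\mathbb{D})$ denotes the collection of all functions on $\mathbb{D}$ of the form $F(z)=|z|^2L(z)+K(z)$, where $L=h_1\overline{g_1}$ is logharmonic and $K=h_2+\overline{g_2}$ is harmonic in $\mathbb{D}$, with $h_1,g_1,h_2,g_2$ analytic in $\mathbb{D}$ (functions with logharmonic Laplacian). Univalent means injective. A schlicht disk is a disk which is the univalent image under the mapping in question of some region in $\mathbb{D}$. Sharpness with extremal function $F_1$ means that $F_1$ satisfies the hypotheses, $F_1$ is not univalent in $\mathbb{D}_r$ for any $r\in(r_1',1]$, and $F_1(\mathbb{D}_{r_1'})$ contains no disk $\mathbb{D}_\rho$ with $\rho>\rho_1'$.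
   Formalization: The formal theorem adds the normalization L(0)=0, also required of the extremal function; without it the claim fails, e.g. L=1, K(z)=z, Λ₂=0 gives F(z)=z+|z|², which takes the same value at -1/4 and -3/4. *)

theory Defs
  imports "HOL-Complex_Analysis.Complex_Analysis"
begin

definition wirtinger :: "(complex \<Rightarrow> complex) \<Rightarrow> complex \<Rightarrow> complex" where
  "wirtinger f z =
     (frechet_derivative f (at z) 1 - \<i> * frechet_derivative f (at z) \<i>) / 2"

definition wirtinger_bar :: "(complex \<Rightarrow> complex) \<Rightarrow> complex \<Rightarrow> complex" where
  "wirtinger_bar f z =
     (frechet_derivative f (at z) 1 + \<i> * frechet_derivative f (at z) \<i>) / 2"

definition Lambda_max :: "(complex \<Rightarrow> complex) \<Rightarrow> complex \<Rightarrow> real" where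
  "Lambda_max f z = cmod (wirtinger f z) + cmod (wirtinger_bar f z)"

definition lambda_min :: "(complex \<Rightarrow> complex) \<Rightarrow> complex \<Rightarrow> real" where
  "lambda_min f z = \<bar>cmod (wirtinger f z) - cmod (wirtinger_bar f z)\<bar>"

definition C1_on :: "complex set \<Rightarrow> (complex \<Rightarrow> complex) \<Rightarrow> bool" where
  "C1_on S f \<longleftrightarrow> (\<forall>z\<in>S. f differentiable (at z)) \<and>
     continuous_on S (wirtinger f) \<and> continuous_on S (wirtinger_bar f)"

definition harmonic_on :: "complex set \<Rightarrow> (complex \<Rightarrow> complex) \<Rightarrow> bool" where
  "harmonic_on S f \<longleftrightarrow>
     C1_on S f \<and> C1_on S (wirtinger f) \<and> C1_on S (wirtinger_bar f) \<and>
     (\<forall>z\<in>S. 4 * wirtinger (wirtinger_bar f) z = 0)"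

text \<open>The equation is imposed where both sides are defined, i.e. off the zeros of \<open>f\<close>;
  logharmonic functions may have zeros, and the zero function is admitted.\<close>

definition logharmonic_on :: "complex set \<Rightarrow> (complex \<Rightarrow> complex) \<Rightarrow> bool" where
  "logharmonic_on S f \<longleftrightarrow> C1_on S f \<and>
     (\<exists>a. a holomorphic_on S \<and> (\<forall>z\<in>S. cmod (a z) < 1) \<and>
        (\<forall>z\<in>S. f z \<noteq> 0 \<longrightarrow>
           cnj (wirtinger_bar f z) / cnj (f z) = a z * (wirtinger f z / f z)))"

text \<open>\<open>F\<close> belongs to the class of functions with logharmonic Laplacian on the unit disk,
  as witnessed by the components \<open>L\<close> and \<open>K\<close>.\<close>

definition logharmonic_laplacian ::
    "(complex \<Rightarrow> complex) \<Rightarrow> (complex \<Rightarrow> complex) \<Rightarrow> (complex \<Rightarrow> complex) \<Rightarrow> bool" where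
  "logharmonic_laplacian F L K \<longleftrightarrow>
     (\<forall>z\<in>ball 0 1. F z = of_real ((cmod z)\<^sup>2) * L z + K z) \<and>
     logharmonic_on (ball 0 1) L \<and>
     (\<exists>h g. h holomorphic_on ball 0 1 \<and> g holomorphic_on ball 0 1 \<and>
        (\<forall>z\<in>ball 0 1. L z = h z * cnj (g z))) \<and>
     harmonic_on (ball 0 1) K \<and>
     (\<exists>h g. h holomorphic_on ball 0 1 \<and> g holomorphic_on ball 0 1 \<and>
        (\<forall>z\<in>ball 0 1. K z = h z + cnj (g z)))"

text \<open>These hypotheses constrain \<open>K 0\<close> (through \<open>F 0 = 0\<close>) but not \<open>L 0\<close>, and alone they do not
  yield univalence with a radius depending on \<open>\<Lambda>\<^sub>2\<close> only: \<open>L = 1\<close>, \<open>K z = z\<close>, \<open>\<Lambda>\<^sub>2 = 0\<close> satisfy them,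
  while \<open>z + \<bar>z\<bar>\<^sup>2\<close> takes the same value at \<open>-1/4\<close> and \<open>-3/4\<close>.  The normalization \<open>L 0 = 0\<close>, under
  which \<open>\<bar>L z\<bar> \<le> \<Lambda>\<^sub>2 \<bar>z\<bar>\<close>, is therefore stated as a separate assumption.\<close>

definition landau_hypotheses ::
    "real \<Rightarrow> (complex \<Rightarrow> complex) \<Rightarrow> (complex \<Rightarrow> complex) \<Rightarrow> (complex \<Rightarrow> complex) \<Rightarrow> bool" where
  "landau_hypotheses \<Lambda>\<^sub>2 F L K \<longleftrightarrow>
     logharmonic_laplacian F L K \<and>
     F 0 = 0 \<and> lambda_min F 0 - 1 = 0 \<and>
     (\<forall>z\<in>ball 0 1. Lambda_max K z \<le> 1) \<and>
     (\<forall>z\<in>ball 0 1. Lambda_max L z \<le> \<Lambda>\<^sub>2)"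

text \<open>\<open>D\<close> is the univalent image under \<open>f\<close> of some region (nonempty connected open set)
  contained in \<open>U\<close>; in particular \<open>D \<subseteq> f ` U\<close>.\<close>

definition schlicht_in ::
    "(complex \<Rightarrow> complex) \<Rightarrow> complex set \<Rightarrow> complex set \<Rightarrow> bool" where
  "schlicht_in f U D \<longleftrightarrow>
     (\<exists>G. G \<subseteq> U \<and> G \<noteq> {} \<and> open G \<and> connected G \<and> inj_on f G \<and> f ` G = D)"

end

theory Submission
  imports Defs
begin

text \<open>
  The derivative of \<open>\<bar>z\<bar>\<^sup>2 L z\<close> vanishes at \<open>0\<close>, so \<open>\<lambda>\<^sub>K(0) = \<lambda>\<^sub>F(0) = 1 \<ge> \<Lambda>\<^sub>K(0)\<close>.  Hence one of
  \<open>h'(0)\<close>, \<open>g'(0)\<close> in \<open>K = h + cnj g\<close> is unimodular.  As \<open>\<bar>h'\<bar> + \<bar>g'\<bar> \<le> 1\<close>, the maximum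
  principle makes that derivative constant and the other one zero, so \<open>K\<close> is \<open>c z\<close> or \<open>c cnj z\<close>
  with \<open>\<bar>c\<bar> = 1\<close>.  Thus \<open>F\<close> is a linear isometry perturbed by \<open>\<bar>z\<bar>\<^sup>2 L z\<close>, whose Lipschitz
  constant on \<open>\<bar>z\<bar> \<le> s\<close> is at most \<open>3 \<Lambda>\<^sub>2 s\<^sup>2\<close>.  This is less than \<open>1\<close> for \<open>s < r\<^sub>1\<close>, which gives injectivity,
  and the contraction principle yields the covered disk.
\<close>

section \<open>Cubic perturbations of isometries\<close>

text \<open>The factor 3 is that of the product rule: varying \<open>L\<close> costs
  \<open>M * s\<^sup>2\<close>, and varying the weight costs \<open>2 * s\<close> times the bound
  \<open>M * s\<close> for \<open>L y\<close>.\<close>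

lemma norm_square_scaled_diff_le:
  fixes L :: "'a::real_inner \<Rightarrow> 'b::real_normed_vector"
  assumes lip: "norm (L x - L y) \<le> M * norm (x - y)" and Ly: "norm (L y) \<le> M * norm y"
    and x: "norm x \<le> s" and y: "norm y \<le> s" and M: "0 \<le> M"
  shows "norm ((norm x)\<^sup>2 *\<^sub>R L x - (norm y)\<^sup>2 *\<^sub>R L y) \<le> 3 * M * s\<^sup>2 * norm (x - y)"
proof -
  have s: "0 \<le> s" using x norm_ge_zero order_trans by blast
  have eq: "(norm x)\<^sup>2 *\<^sub>R L x - (norm y)\<^sup>2 *\<^sub>R L y
      = (norm x)\<^sup>2 *\<^sub>R (L x - L y) + ((norm x)\<^sup>2 - (norm y)\<^sup>2) *\<^sub>R L y"
    by (simp add: algebra_simps)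
  have sq: "(norm x)\<^sup>2 \<le> s\<^sup>2" using x by (simp add: power_mono)
  have 1: "(norm x)\<^sup>2 * norm (L x - L y) \<le> s\<^sup>2 * (M * norm (x - y))"
    using sq lip by (intro mult_mono) auto
  have "\<bar>(norm x)\<^sup>2 - (norm y)\<^sup>2\<bar> = \<bar>norm x - norm y\<bar> * (norm x + norm y)"
    by (simp add: power2_eq_square square_diff_square_factored abs_mult)
  also have "\<dots> \<le> norm (x - y) * (2 * s)"
    using x y norm_triangle_ineq3[of x y] by (intro mult_mono) auto
  finally have d: "\<bar>(norm x)\<^sup>2 - (norm y)\<^sup>2\<bar> \<le> norm (x - y) * (2 * s)" .
  have "norm (L y) \<le> M * s" using Ly mult_left_mono[OF y M] by linarith
  with d have 2: "\<bar>(norm x)\<^sup>2 - (norm y)\<^sup>2\<bar> * norm (L y) \<le> (norm (x - y) * (2 * s)) * (M * s)"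
    using s by (intro mult_mono) auto
  have "norm ((norm x)\<^sup>2 *\<^sub>R L x - (norm y)\<^sup>2 *\<^sub>R L y)
      \<le> (norm x)\<^sup>2 * norm (L x - L y) + \<bar>(norm x)\<^sup>2 - (norm y)\<^sup>2\<bar> * norm (L y)"
    unfolding eq by (rule order_trans[OF norm_triangle_ineq]) simp
  also have "\<dots> \<le> s\<^sup>2 * (M * norm (x - y)) + (norm (x - y) * (2 * s)) * (M * s)"
    using 1 2 by simp
  also have "\<dots> = 3 * M * s\<^sup>2 * norm (x - y)"
    by (simp add: power2_eq_square algebra_simps)
  finally show ?thesis .
qed

text \<open>Equality is allowed at \<open>r\<close>, so strictness must come from
  \<open>s < r\<close>; this works for positive \<open>M\<close>, and \<open>M = 0\<close> is
  trivial.\<close>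

lemma triple_square_less_one:
  fixes M :: real
  assumes "0 \<le> M" "0 \<le> s" "s < r" "3 * M * r\<^sup>2 \<le> 1"
  shows "3 * M * s\<^sup>2 < 1"
proof (cases "M = 0")
  case False
  have "s\<^sup>2 < r\<^sup>2" using assms by (simp add: power_strict_mono)
  then have "3 * M * s\<^sup>2 < 3 * M * r\<^sup>2" using False assms by simp
  then show ?thesis using assms by linarith
qed simp

text \<open>If two images agree, the isometry \<open>T\<close> and the cubic term move by the same
  distance, but the cubic term has Lipschitz constant below 1 at the radius of the two
  points.\<close>

lemma cubic_perturbation_inj_on:
  fixes T L :: "'a::euclidean_space \<Rightarrow> 'a"
  assumes T: "orthogonal_transformation T" and M: "0 \<le> M" and r: "3 * M * r\<^sup>2 \<le> 1"
    and lip: "\<And>x y. x \<in> ball 0 r \<Longrightarrow> y \<in> ball 0 r \<Longrightarrow> norm (L x - L y) \<le> M * norm (x - y)"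
    and bound: "\<And>x. x \<in> ball 0 r \<Longrightarrow> norm (L x) \<le> M * norm x"
  shows "inj_on (\<lambda>x. (norm x)\<^sup>2 *\<^sub>R L x + T x) (ball 0 r)"
proof (rule inj_onI)
  fix x y
  assume x: "x \<in> ball 0 r" and y: "y \<in> ball 0 r"
    and eq: "(norm x)\<^sup>2 *\<^sub>R L x + T x = (norm y)\<^sup>2 *\<^sub>R L y + T y"
  \<comment> \<open>The larger of the two norms stays strictly below \<open>r\<close>; at
    \<open>r\<close> itself the Lipschitz constant may reach 1.\<close>
  define s where "s = max (norm x) (norm y)"
  have s: "0 \<le> s" "s < r" using x y by (auto simp: s_def le_max_iff_disj)
  have "T y - T x = (norm x)\<^sup>2 *\<^sub>R L x - (norm y)\<^sup>2 *\<^sub>R L y"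
    using eq by (simp add: algebra_simps)
  moreover have "norm (T y - T x) = norm (x - y)"
    using T by (metis linear_diff norm_minus_commute orthogonal_transformation_linear
        orthogonal_transformation_norm)
  moreover have "norm ((norm x)\<^sup>2 *\<^sub>R L x - (norm y)\<^sup>2 *\<^sub>R L y) \<le> 3 * M * s\<^sup>2 * norm (x - y)"
    by (rule norm_square_scaled_diff_le) (use x y lip bound M in \<open>auto simp: s_def\<close>)
  ultimately have "norm (x - y) \<le> 3 * M * s\<^sup>2 * norm (x - y)" by simp
  moreover have "3 * M * s\<^sup>2 < 1" using triple_square_less_one[OF M s r] .
  ultimately have "\<not> 0 < norm (x - y)"
    using mult_strict_right_mono[of "3 * M * s\<^sup>2" 1 "norm (x - y)"] by linarith
  then show "x = y" by simp
qed

text \<open>Solving for a preimage of \<open>w\<close> is a fixed point problem for the map sending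
  \<open>x\<close> to the inverse of \<open>T\<close> applied to \<open>w\<close> minus the cubic
  term. It sends the closed ball of radius \<open>s\<close> into itself once
  \<open>norm w + M * s ^ 3 \<le> s\<close>.\<close>

lemma cubic_perturbation_covers:
  fixes T L :: "'a::euclidean_space \<Rightarrow> 'a"
  assumes T: "orthogonal_transformation T" and M: "0 \<le> M" and r: "3 * M * r\<^sup>2 \<le> 1" "0 < r"
    and lip: "\<And>x y. x \<in> ball 0 r \<Longrightarrow> y \<in> ball 0 r \<Longrightarrow> norm (L x - L y) \<le> M * norm (x - y)"
    and bound: "\<And>x. x \<in> ball 0 r \<Longrightarrow> norm (L x) \<le> M * norm x"
  shows "ball 0 (r - M * r ^ 3) \<subseteq> (\<lambda>x. (norm x)\<^sup>2 *\<^sub>R L x + T x) ` ball 0 r"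
proof
  fix w :: 'a
  assume "w \<in> ball 0 (r - M * r ^ 3)"
  then have w: "norm w < r - M * r ^ 3" by simp
  \<comment> \<open>Passing to a radius \<open>s < r\<close> gives a complete ball inside the domain
    of the bounds and a strict contraction; continuity keeps \<open>norm w\<close> below
    \<open>s - M * s ^ 3\<close>.\<close>
  have "((\<lambda>s. s - M * s ^ 3) \<longlongrightarrow> r - M * r ^ 3) (at_left r)"
    by (intro tendsto_intros)
  then have "\<forall>\<^sub>F s in at_left r. norm w < s - M * s ^ 3"
    using w by (rule order_tendstoD)
  moreover have "\<forall>\<^sub>F s in at_left r. s \<in> {0<..<r}"
    using r(2) by (rule eventually_at_left_real)
  ultimately have "\<forall>\<^sub>F s in at_left r. norm w < s - M * s ^ 3 \<and> s \<in> {0<..<r}"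
    by (rule eventually_conj)
  then obtain s where s: "norm w < s - M * s ^ 3" "0 < s" "s < r"
    using eventually_happens[of _ "at_left r"] by (auto simp: trivial_limit_at_left_real)
  define S where "S = inv T"
  have S: "orthogonal_transformation S"
    unfolding S_def using T by (rule orthogonal_transformation_inv)
  have TS: "T (S v) = v" for v
    unfolding S_def using orthogonal_transformation_surj[OF T] by (rule surj_f_inv_f)
  let ?c = "3 * M * s\<^sup>2" and ?f = "\<lambda>x. S (w - (norm x)\<^sup>2 *\<^sub>R L x)"
  have "\<exists>!x\<in>cball 0 s. ?f x = x"
  proof (rule Banach_fix)
    show "?c < 1" using triple_square_less_one[OF M _ s(3) r(1)] s by simp
    show "?f ` cball 0 s \<subseteq> cball 0 s"
    proof safe
      fix x :: 'a assume "x \<in> cball 0 s"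
      then have x: "norm x \<le> s" by simp
      have "norm (L x) \<le> M * norm x" using bound x s by simp
      also have "\<dots> \<le> M * s" using x M by (rule mult_left_mono)
      finally have "(norm x)\<^sup>2 * norm (L x) \<le> s\<^sup>2 * (M * s)"
        using x by (intro mult_mono power_mono) auto
      also have "\<dots> = M * s ^ 3" by (simp add: power2_eq_square power3_eq_cube)
      finally have "norm (w - (norm x)\<^sup>2 *\<^sub>R L x) \<le> norm w + M * s ^ 3"
        using norm_triangle_ineq4[of w "(norm x)\<^sup>2 *\<^sub>R L x"] by simp
      then show "?f x \<in> cball 0 s"
        using s(1) by (simp add: orthogonal_transformation_norm[OF S])
    qed
    fix x y :: 'a assume xy: "x \<in> cball 0 s" "y \<in> cball 0 s"
    have "?f x - ?f y = S ((norm y)\<^sup>2 *\<^sub>R L y - (norm x)\<^sup>2 *\<^sub>R L x)"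
      using linear_diff[OF orthogonal_transformation_linear[OF S], symmetric] by simp
    then have "dist (?f x) (?f y) = norm ((norm x)\<^sup>2 *\<^sub>R L x - (norm y)\<^sup>2 *\<^sub>R L y)"
      by (simp add: dist_norm orthogonal_transformation_norm[OF S] norm_minus_commute)
    also have "\<dots> \<le> ?c * norm (x - y)"
      by (rule norm_square_scaled_diff_le) (use xy s lip bound M in auto)
    finally show "dist (?f x) (?f y) \<le> ?c * dist x y" by (simp add: dist_norm)
  qed (use M s in \<open>auto simp: complete_eq_closed\<close>)
  then obtain x where x: "x \<in> cball 0 s" "?f x = x" by blast
  then have "T x = w - (norm x)\<^sup>2 *\<^sub>R L x" using TS by metis
  then have "w = (norm x)\<^sup>2 *\<^sub>R L x + T x" by simp
  then show "w \<in> (\<lambda>x. (norm x)\<^sup>2 *\<^sub>R L x + T x) ` ball 0 r"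
    using x(1) s(3) by (intro image_eqI[of _ _ x]) auto
qed

section \<open>Schlicht disks from covered disks\<close>

text \<open>The region is the preimage of \<open>D\<close> in \<open>U\<close>. Invariance of domain
  makes the inverse of \<open>f\<close> continuous, so this preimage is the continuous image of a
  connected set.\<close>

lemma schlicht_inI:
  assumes U: "open U" and f: "continuous_on U f" "inj_on f U"
    and D: "open D" "connected D" "D \<noteq> {}" "D \<subseteq> f ` U"
  shows "schlicht_in f U D"
proof -
  define G where "G = U \<inter> f -` D"
  obtain g where g: "homeomorphism U (f ` U) f g"
    using invariance_of_domain_homeomorphism[OF U f(1) _ f(2)] by auto
  have img: "f ` G = D" using D(4) by (auto simp: G_def)
  have "G = g ` D"
    using g D(4) by (fastforce simp: G_def homeomorphism_def image_iff)
  moreover have "continuous_on D g"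
    using g D(4) continuous_on_subset by (auto simp: homeomorphism_def)
  ultimately have "connected G" using D(2) by (simp add: connected_continuous_image)
  moreover have "open G" unfolding G_def by (rule continuous_open_preimage[OF f(1) U D(1)])
  moreover have "inj_on f G" using f(2) by (auto simp: G_def inj_on_def)
  ultimately show ?thesis
    unfolding schlicht_in_def using img D(3) by (intro exI[of _ G]) (auto simp: G_def)
qed

section \<open>Wirtinger derivatives\<close>

text \<open>A real-linear map of the plane is determined by its values at 1 and \<open>\<i>\<close>,
  and the Wirtinger derivatives are its coefficients with respect to \<open>v\<close> and
  \<open>cnj v\<close>.\<close>

lemma has_derivative_wirtinger:
  assumes "f differentiable (at z)"
  shows "(f has_derivative (\<lambda>v. wirtinger f z * v + wirtinger_bar f z * cnj v)) (at z)"
proof -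
  let ?D = "frechet_derivative f (at z)"
  have D: "(f has_derivative ?D) (at z)" using assms by (simp add: frechet_derivative_works)
  interpret linear ?D using D by (rule has_derivative_linear)
  have "?D v = wirtinger f z * v + wirtinger_bar f z * cnj v" for v
  proof -
    have "?D v = ?D (Re v *\<^sub>R 1 + Im v *\<^sub>R \<i>)"
      by (rule arg_cong[of _ _ ?D]) (simp add: complex_eq_iff)
    also have "\<dots> = Re v *\<^sub>R ?D 1 + Im v *\<^sub>R ?D \<i>" by (simp add: add scale)
    also have "\<dots> = wirtinger f z * v + wirtinger_bar f z * cnj v"
      by (simp add: wirtinger_def wirtinger_bar_def complex_eq_iff field_simps)
    finally show ?thesis .
  qed
  then have "?D = (\<lambda>v. wirtinger f z * v + wirtinger_bar f z * cnj v)" by (rule ext)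
  then show ?thesis using D by simp
qed

text \<open>Converse reading: uniqueness of the derivative lets both Wirtinger derivatives be read
  off from any derivative in this shape.\<close>

lemma wirtinger_eqI:
  assumes "(f has_derivative (\<lambda>v. a * v + b * cnj v)) (at z)"
  shows "wirtinger f z = a" and "wirtinger_bar f z = b"
proof -
  have "frechet_derivative f (at z) = (\<lambda>v. a * v + b * cnj v)"
    by (rule frechet_derivative_at[OF assms, symmetric])
  then show "wirtinger f z = a" "wirtinger_bar f z = b"
    by (simp_all add: wirtinger_def wirtinger_bar_def complex_eq_iff)
qed

text \<open>\<open>Lambda_max\<close> bounds the operator norm of the real derivative, so the mean
  value inequality on a convex set applies.\<close>

lemma lipschitz_of_Lambda_max_le:
  assumes "convex S" "C1_on S f" "\<And>z. z \<in> S \<Longrightarrow> Lambda_max f z \<le> M" "x \<in> S" "y \<in> S"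
  shows "cmod (f x - f y) \<le> M * cmod (x - y)"
proof (rule differentiable_bound[OF assms(1), where f = f
      and f' = "\<lambda>z v. wirtinger f z * v + wirtinger_bar f z * cnj v"])
  fix z assume z: "z \<in> S"
  show "(f has_derivative (\<lambda>v. wirtinger f z * v + wirtinger_bar f z * cnj v)) (at z within S)"
    by (rule has_derivative_at_withinI[OF has_derivative_wirtinger])
      (use assms(2) z in \<open>simp add: C1_on_def\<close>)
  show "onorm (\<lambda>v. wirtinger f z * v + wirtinger_bar f z * cnj v) \<le> M"
  proof (rule onorm_le)
    fix v
    have "cmod (wirtinger f z * v + wirtinger_bar f z * cnj v) \<le> Lambda_max f z * cmod v"
      using norm_triangle_ineq[of "wirtinger f z * v" "wirtinger_bar f z * cnj v"]
      by (simp add: Lambda_max_def norm_mult distrib_right)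
    also have "\<dots> \<le> M * cmod v" using assms(3)[OF z] by (simp add: mult_right_mono)
    finally show "cmod (wirtinger f z * v + wirtinger_bar f z * cnj v) \<le> M * cmod v" .
  qed
qed (rule assms)+

section \<open>Rigidity of the harmonic part\<close>

text \<open>The modulus of \<open>deriv h\<close> attains its maximum at the centre, so the maximum
  modulus principle makes \<open>deriv h\<close> constant.\<close>

lemma holomorphic_affine_of_deriv_max:
  assumes h: "h holomorphic_on ball 0 1" and le: "\<And>z. z \<in> ball 0 1 \<Longrightarrow> cmod (deriv h z) \<le> 1"
    and max: "cmod (deriv h 0) = 1" and z: "z \<in> ball 0 1"
  shows "deriv h z = deriv h 0" and "h z = h 0 + deriv h 0 * z"
proof -
  have "deriv h constant_on ball 0 1"
    by (rule maximum_modulus_principle[where U = "ball 0 1" and \<xi> = 0])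
      (use h le max in \<open>auto intro: holomorphic_deriv\<close>)
  then have const: "deriv h w = deriv h 0" if "w \<in> ball 0 1" for w
    using that unfolding constant_on_def by (metis centre_in_ball zero_less_one)
  then show "deriv h z = deriv h 0" using z .
  have "((\<lambda>w. h w - deriv h 0 * w) has_field_derivative 0) (at w within ball 0 1)"
    if "w \<in> ball 0 1" for w
    using holomorphic_derivI[OF h open_ball that] const[OF that]
    by (auto intro!: derivative_eq_intros)
  then have "\<exists>c. \<forall>w\<in>ball 0 1. h w - deriv h 0 * w = c"
    by (intro has_field_derivative_zero_constant) auto
  then have "h z - deriv h 0 * z = h 0 - deriv h 0 * 0"
    using z by (metis centre_in_ball zero_less_one)
  then show "h z = h 0 + deriv h 0 * z" by (simp add: algebra_simps)
qed

lemma holomorphic_const_of_deriv_zero: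
  assumes h: "h holomorphic_on ball 0 1" and "\<And>z. z \<in> ball 0 1 \<Longrightarrow> deriv h z = 0"
    and z: "z \<in> ball 0 1"
  shows "h z = h 0"
proof -
  have "\<exists>c. \<forall>w\<in>ball 0 1. h w = c"
    using holomorphic_derivI[OF h open_ball] assms(2)
    by (intro has_field_derivative_zero_constant) force+
  then show ?thesis using z by (metis centre_in_ball zero_less_one)
qed

lemma orthogonal_transformation_mult:
  "cmod c = 1 \<Longrightarrow> orthogonal_transformation (\<lambda>z. c * z)"
  by (auto simp: orthogonal_transformation norm_mult linear_iff algebra_simps)

lemma orthogonal_transformation_mult_cnj:
  "cmod c = 1 \<Longrightarrow> orthogonal_transformation (\<lambda>z. c * cnj z)"
  by (auto simp: orthogonal_transformation norm_mult linear_iff algebra_simps)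

text \<open>The two conditions at 0 force one of the derivatives of \<open>h\<close> and
  \<open>g\<close> to be unimodular there. It is then constant, and the bound on the sum of the
  moduli leaves no room for the other derivative anywhere.\<close>

lemma harmonic_isometry_of_extremal:
  assumes h: "h holomorphic_on ball 0 1" and g: "g holomorphic_on ball 0 1"
    and K: "\<And>z. z \<in> ball 0 1 \<Longrightarrow> K z = h z + cnj (g z)"
    and le: "\<And>z. z \<in> ball 0 1 \<Longrightarrow> Lambda_max K z \<le> 1"
    and one: "lambda_min K 0 = 1" and K0: "K 0 = 0"
  obtains T where "orthogonal_transformation T" "\<And>z. z \<in> ball 0 1 \<Longrightarrow> K z = T z"
proof -
  have w: "wirtinger K z = deriv h z" "wirtinger_bar K z = cnj (deriv g z)"
    if z: "z \<in> ball 0 1" for z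
  proof -
    have "(h has_derivative (*) (deriv h z)) (at z)" "(g has_derivative (*) (deriv g z)) (at z)"
      using holomorphic_derivI[OF h open_ball z] holomorphic_derivI[OF g open_ball z]
      by (simp_all add: has_field_derivative_def)
    then have "((\<lambda>z. h z + cnj (g z)) has_derivative
        (\<lambda>v. deriv h z * v + cnj (deriv g z * v))) (at z)"
      by (intro has_derivative_add has_derivative_cnj)
    then have "(K has_derivative (\<lambda>v. deriv h z * v + cnj (deriv g z) * cnj v)) (at z)"
      using has_derivative_transform_within_open[OF _ open_ball z] K by fastforce
    then show "wirtinger K z = deriv h z" "wirtinger_bar K z = cnj (deriv g z)"
      by (rule wirtinger_eqI)+
  qed
  have sum: "cmod (deriv h z) + cmod (deriv g z) \<le> 1" if "z \<in> ball 0 1" for z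
    using le[OF that] w[OF that] by (simp add: Lambda_max_def)
  have hle: "cmod (deriv h z) \<le> 1" and gle: "cmod (deriv g z) \<le> 1" if "z \<in> ball 0 1" for z
    using sum[OF that] norm_ge_zero[of "deriv h z"] norm_ge_zero[of "deriv g z"]
    by linarith+
  \<comment> \<open>Constants may be shifted between \<open>h\<close> and \<open>g\<close>, so only
    this combination of their values at 0 is determined.\<close>
  have K0': "h 0 + cnj (g 0) = 0" using K K0 by simp
  \<comment> \<open>Two numbers in the unit interval at distance 1 are 0 and 1.\<close>
  have "\<bar>cmod (deriv h 0) - cmod (deriv g 0)\<bar> = 1"
    using one w[of 0] by (simp add: lambda_min_def)
  moreover have "cmod (deriv h 0) \<le> 1" "cmod (deriv g 0) \<le> 1"
    using hle[of 0] gle[of 0] by simp_all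
  ultimately consider "cmod (deriv h 0) = 1" | "cmod (deriv g 0) = 1"
    using norm_ge_zero[of "deriv h 0"] norm_ge_zero[of "deriv g 0"] by linarith
  then show ?thesis
  proof cases
    case 1
    have "deriv g z = 0" if "z \<in> ball 0 1" for z
      using sum[OF that] holomorphic_affine_of_deriv_max(1)[OF h hle 1 that] 1 by simp
    then have gc: "g z = g 0" if "z \<in> ball 0 1" for z
      using holomorphic_const_of_deriv_zero[OF g _ that] by blast
    have "K z = deriv h 0 * z" if "z \<in> ball 0 1" for z
      using K[OF that] gc[OF that] holomorphic_affine_of_deriv_max(2)[OF h hle 1 that] K0'
      by (simp add: algebra_simps)
    with orthogonal_transformation_mult[OF 1] show ?thesis by (rule that)
  next
    case 2
    have "deriv h z = 0" if "z \<in> ball 0 1" for z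
      using sum[OF that] holomorphic_affine_of_deriv_max(1)[OF g gle 2 that] 2 by simp
    then have hc: "h z = h 0" if "z \<in> ball 0 1" for z
      using holomorphic_const_of_deriv_zero[OF h _ that] by blast
    have "K z = cnj (deriv g 0) * cnj z" if "z \<in> ball 0 1" for z
      using K[OF that] hc[OF that] holomorphic_affine_of_deriv_max(2)[OF g gle 2 that] K0'
      by (simp add: algebra_simps)
    moreover have "orthogonal_transformation (\<lambda>z. cnj (deriv g 0) * cnj z)"
      using 2 by (intro orthogonal_transformation_mult_cnj) simp
    ultimately show ?thesis using that by blast
  qed
qed

text \<open>Written as \<open>z * cnj z\<close>, the weight is visibly differentiable and vanishes
  to second order at 0, so its product with \<open>L\<close> contributes nothing to the derivative
  there.\<close>

lemma lambda_min_add_norm_square_mult: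
  assumes F: "\<And>z. z \<in> ball 0 1 \<Longrightarrow> F z = of_real ((cmod z)\<^sup>2) * L z + K z"
    and L: "L differentiable (at 0)" and K: "K differentiable (at 0)"
  shows "lambda_min F 0 = lambda_min K 0"
proof -
  have "((\<lambda>z. (z * cnj z) * L z + K z) has_derivative
      (\<lambda>v. wirtinger K 0 * v + wirtinger_bar K 0 * cnj v)) (at 0)"
    by (rule derivative_eq_intros has_derivative_wirtinger[OF L] has_derivative_wirtinger[OF K]
        has_derivative_cnj refl | simp)+
  then have "(F has_derivative (\<lambda>v. wirtinger K 0 * v + wirtinger_bar K 0 * cnj v)) (at 0)"
  proof (rule has_derivative_transform_within_open)
    show "(z * cnj z) * L z + K z = F z" if "z \<in> ball 0 1" for z
      using F[OF that] by (simp only: complex_norm_square)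
  qed auto
  from wirtinger_eqI[OF this] show ?thesis by (simp add: lambda_min_def)
qed

section \<open>The extremal function\<close>

text \<open>The zero coefficient is displayed so that the derivative has the shape expected by
  \<open>wirtinger_eqI\<close>.\<close>

lemma has_derivative_mult_wirtinger:
  "((\<lambda>z. c * z) has_derivative (\<lambda>v. c * v + 0 * cnj v)) (at z)"
  by (auto intro!: derivative_eq_intros)

lemma has_derivative_const_wirtinger:
  "((\<lambda>z. c) has_derivative (\<lambda>v. 0 * v + 0 * cnj v)) (at z)"
  by simp

lemmas wirtinger_mult [simp] = wirtinger_eqI[OF has_derivative_mult_wirtinger]
lemmas wirtinger_const [simp] = wirtinger_eqI[OF has_derivative_const_wirtinger]

lemma C1_on_const [simp]: "C1_on S (\<lambda>z. c)"
  by (simp add: C1_on_def wirtinger_const[abs_def])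

lemma C1_on_mult: "C1_on S (\<lambda>z. c * z)"
  by (simp add: C1_on_def wirtinger_mult[abs_def])

lemma harmonic_on_id: "harmonic_on S (\<lambda>z. z)"
proof -
  have "wirtinger (\<lambda>z. z) = (\<lambda>z. 1)" "wirtinger_bar (\<lambda>z. z) = (\<lambda>z. 0)"
    using wirtinger_mult[of 1] by (simp_all add: fun_eq_iff)
  then show ?thesis using C1_on_mult[of S 1] by (simp add: harmonic_on_def)
qed

text \<open>The function is analytic, so the equation holds with \<open>a\<close> identically
  zero.\<close>

lemma logharmonic_on_mult: "logharmonic_on S (\<lambda>z. c * z)"
  unfolding logharmonic_on_def by (auto intro!: C1_on_mult exI[of _ "\<lambda>_. 0"])

text \<open>The cubic term is the squared modulus of \<open>z\<close> times
  \<open>- of_real M * z\<close>; this choice of \<open>L\<close> has \<open>Lambda_max\<close>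
  equal to \<open>M\<close> everywhere, so the bound is attained.\<close>

lemma landau_hypotheses_extremal:
  assumes "0 \<le> M"
  shows "landau_hypotheses M (\<lambda>z. z - of_real M * z\<^sup>2 * cnj z) (\<lambda>z. - of_real M * z) (\<lambda>z. z)"
proof -
  let ?F = "\<lambda>z. z - of_real M * z\<^sup>2 * cnj z" and ?L = "\<lambda>z. - of_real M * z"
  have F: "?F z = of_real ((cmod z)\<^sup>2) * ?L z + z" for z
    using complex_norm_square[of z] by (simp add: power2_eq_square)
  have w: "wirtinger (\<lambda>z. z) z = 1" "wirtinger_bar (\<lambda>z. z) z = 0" for z
    using wirtinger_mult[of 1] by simp_all
  have "lambda_min ?F 0 = lambda_min (\<lambda>z. z) 0"
    by (rule lambda_min_add_norm_square_mult[of _ ?L]) (use F in auto)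
  moreover have "logharmonic_laplacian ?F ?L (\<lambda>z. z)"
    unfolding logharmonic_laplacian_def
  proof (intro conjI ballI)
    show "?F z = of_real ((cmod z)\<^sup>2) * ?L z + z" for z by (rule F)
    show "\<exists>h g. h holomorphic_on ball 0 1 \<and> g holomorphic_on ball 0 1 \<and>
        (\<forall>z\<in>ball 0 1. ?L z = h z * cnj (g z))"
      by (intro exI[of _ ?L] exI[of _ "\<lambda>_. 1"]) (auto intro!: holomorphic_intros)
    show "\<exists>h g. h holomorphic_on ball 0 1 \<and> g holomorphic_on ball 0 1 \<and>
        (\<forall>z\<in>ball 0 1. z = h z + cnj (g z))"
      by (intro exI[of _ "\<lambda>z. z"] exI[of _ "\<lambda>_. 0"]) (auto intro!: holomorphic_intros)
  qed (rule logharmonic_on_mult harmonic_on_id)+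
  moreover have "Lambda_max ?L z = M" for z
    using assms wirtinger_mult[of "- of_real M" z] by (simp add: Lambda_max_def)
  ultimately show ?thesis
    by (simp add: landau_hypotheses_def lambda_min_def Lambda_max_def w)
qed

text \<open>The difference of the two sides factors as
  \<open>(r - s) * (1 - M * (r\<^sup>2 + r * s + s\<^sup>2))\<close>. Each of the three products
  with \<open>M\<close> is at most 1/3, the one with \<open>s\<^sup>2\<close> strictly less.\<close>

lemma cubic_less:
  fixes M :: real
  assumes "0 \<le> M" "0 \<le> s" "s < r" "3 * M * r\<^sup>2 \<le> 1"
  shows "s - M * s ^ 3 < r - M * r ^ 3"
proof -
  have sr: "s * r \<le> r\<^sup>2" using assms by (simp add: power2_eq_square mult_right_mono)
  have s1: "3 * (M * s\<^sup>2) < 1" using triple_square_less_one[OF assms] by simp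
  have "M * (s * r) \<le> M * r\<^sup>2" using sr assms by (intro mult_left_mono) auto
  then have "M * (r\<^sup>2 + r * s + s\<^sup>2) < 1" using s1 assms(4)
    by (simp add: algebra_simps)
  then have "0 < (r - s) * (1 - M * (r\<^sup>2 + r * s + s\<^sup>2))" using assms by simp
  also have "\<dots> = (r - M * r ^ 3) - (s - M * s ^ 3)"
    by (simp add: algebra_simps power2_eq_square power3_eq_cube)
  finally show ?thesis by simp
qed

text \<open>The modulus of the image depends only on \<open>cmod z\<close> and increases with it up
  to \<open>r\<close>, so the point \<open>r - M * r ^ 3\<close> itself is never attained in the
  open disk.\<close>

lemma extremal_not_covers:
  assumes M: "0 \<le> M" and r: "0 < r" "3 * M * r\<^sup>2 \<le> 1" and \<rho>: "r - M * r ^ 3 < \<rho>"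
  shows "\<not> ball 0 \<rho> \<subseteq> (\<lambda>z. z - of_real M * z\<^sup>2 * cnj z) ` ball 0 r"
proof
  let ?\<rho> = "r - M * r ^ 3"
  have \<rho>0: "0 < ?\<rho>" using cubic_less[OF M _ r(1) r(2)] by simp
  assume "ball 0 \<rho> \<subseteq> (\<lambda>z. z - of_real M * z\<^sup>2 * cnj z) ` ball 0 r"
  moreover have "complex_of_real ?\<rho> \<in> ball 0 \<rho>"
    unfolding mem_ball_0 norm_of_real using \<rho> \<rho>0 by simp
  ultimately obtain z where z: "cmod z < r" "complex_of_real ?\<rho> = z - of_real M * z\<^sup>2 * cnj z"
    by auto
  have "z - of_real M * z\<^sup>2 * cnj z = of_real (1 - M * (cmod z)\<^sup>2) * z"
    using complex_norm_square[of z] by (simp add: algebra_simps power2_eq_square)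
  then have "cmod (complex_of_real ?\<rho>) = \<bar>1 - M * (cmod z)\<^sup>2\<bar> * cmod z"
    unfolding z(2) by (simp only: norm_mult norm_of_real)
  then have *: "?\<rho> = \<bar>1 - M * (cmod z)\<^sup>2\<bar> * cmod z"
    unfolding norm_of_real using \<rho>0 by simp
  have "3 * M * (cmod z)\<^sup>2 < 1"
    by (rule triple_square_less_one[OF M _ z(1) r(2)]) simp
  then have "\<bar>1 - M * (cmod z)\<^sup>2\<bar> = 1 - M * (cmod z)\<^sup>2" by simp
  note *[unfolded this]
  also have "(1 - M * (cmod z)\<^sup>2) * cmod z = cmod z - M * cmod z ^ 3"
    by (simp add: left_diff_distrib power2_eq_square power3_eq_cube)
  finally have "?\<rho> = cmod z - M * cmod z ^ 3" .
  with cubic_less[OF M _ z(1) r(2)] show False by simp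
qed

text \<open>
  On the real axis the function is \<open>x - M x\<^sup>3\<close>, which turns back at \<open>r\<close>: a value taken just
  beyond \<open>r\<close> is also taken on \<open>[0, r]\<close>.
\<close>
lemma extremal_not_inj_on:
  assumes M: "3 * M * r\<^sup>2 = 1" and r: "0 < r" "r < R"
  shows "\<not> inj_on (\<lambda>z. z - of_real M * z\<^sup>2 * cnj z) (ball 0 R)"
proof
  assume inj: "inj_on (\<lambda>z. z - of_real M * z\<^sup>2 * cnj z) (ball 0 R)"
  \<comment> \<open>The midpoint keeps \<open>y\<close> strictly between \<open>r\<close> and
    \<open>R\<close>; the cap \<open>3 / 2 * r\<close> gives
    \<open>M * y\<^sup>2 \<le> 3 / 4\<close>, hence a nonnegative value at \<open>y\<close>.\<close>
  define y where "y = min ((r + R) / 2) (3 / 2 * r)"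
  have y: "r < y" "y < R" "y \<le> 3 / 2 * r" using r by (auto simp: y_def min_def)
  have "0 < 3 * M * r\<^sup>2" using M by simp
  then have M0: "0 < M" by (simp add: zero_less_mult_iff)
  have "y\<^sup>2 \<le> (3 / 2 * r)\<^sup>2" using y r by (intro power_mono) auto
  then have "M * y\<^sup>2 \<le> M * (3 / 2 * r)\<^sup>2" using M0 by simp
  also have "\<dots> = 3 / 4 * (3 * M * r\<^sup>2)" by (simp add: power2_eq_square)
  finally have "M * y\<^sup>2 \<le> 1" using M by simp
  then have "0 \<le> y * (1 - M * y\<^sup>2)" using y r by simp
  then have lo: "0 \<le> y - M * y ^ 3" by (simp add: algebra_simps power2_eq_square power3_eq_cube)
  \<comment> \<open>Since \<open>r\<close> is a critical point of the cubic, the value at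
    \<open>r\<close> minus the value at \<open>y\<close> has a double zero at \<open>y = r\<close>;
    the remaining factor is \<open>M * (y + 2 * r)\<close>.\<close>
  have "0 \<le> M * ((y - r)\<^sup>2 * (y + 2 * r))" using M0 y r by simp
  also have "\<dots> = M * y ^ 3 - (3 * M * r\<^sup>2) * y + 2 * M * r ^ 3"
    by (simp add: algebra_simps power2_eq_square power3_eq_cube)
  also have "2 * M * r ^ 3 = (3 * M * r\<^sup>2) * r - M * r ^ 3"
    by (simp add: algebra_simps power2_eq_square power3_eq_cube)
  finally have hi: "y - M * y ^ 3 \<le> r - M * r ^ 3" using M by simp
  have "\<exists>x\<ge>0. x \<le> r \<and> x - M * x ^ 3 = y - M * y ^ 3"
    by (rule IVT') (use lo hi r in \<open>auto intro!: continuous_intros\<close>)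
  then obtain x where x: "0 \<le> x" "x \<le> r" "x - M * x ^ 3 = y - M * y ^ 3" by blast
  have real: "complex_of_real t - of_real M * (of_real t)\<^sup>2 * cnj (of_real t)
      = of_real (t - M * t ^ 3)" for t
    by (simp add: power2_eq_square power3_eq_cube)
  have "complex_of_real x = complex_of_real y"
    by (rule inj_onD[OF inj]) (use real[of x] real[of y] x y r in \<open>auto simp del: of_real_diff\<close>)
  then show False using x y by simp
qed

section \<open>Univalence radius, schlicht disk and sharpness for \<open>F\<close>\<close>

theorem theorem3p2:
  fixes F L K :: "complex \<Rightarrow> complex" and \<Lambda>\<^sub>2 :: real
  assumes "landau_hypotheses \<Lambda>\<^sub>2 F L K"
    and "L 0 = 0"
  shows "\<exists>r\<^sub>1 \<rho>\<^sub>1 :: real.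
     r\<^sub>1 = (if 3 * \<Lambda>\<^sub>2 \<le> 1 then 1 else 1 / sqrt (3 * \<Lambda>\<^sub>2)) \<and>
     0 < r\<^sub>1 \<and> r\<^sub>1 \<le> 1 \<and>
     \<rho>\<^sub>1 = r\<^sub>1 - r\<^sub>1 ^ 3 * \<Lambda>\<^sub>2 \<and>
     inj_on F (ball 0 r\<^sub>1) \<and>
     schlicht_in F (ball 0 r\<^sub>1) (ball 0 \<rho>\<^sub>1) \<and>
     (let F\<^sub>1 = (\<lambda>z. z - of_real \<Lambda>\<^sub>2 * z\<^sup>2 * cnj z) in
        (\<exists>L\<^sub>1 K\<^sub>1. landau_hypotheses \<Lambda>\<^sub>2 F\<^sub>1 L\<^sub>1 K\<^sub>1 \<and> L\<^sub>1 0 = 0) \<and>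
        (\<forall>r. r\<^sub>1 < r \<and> r \<le> 1 \<longrightarrow> \<not> inj_on F\<^sub>1 (ball 0 r)) \<and>
        (\<forall>\<rho>. \<rho>\<^sub>1 < \<rho> \<longrightarrow> \<not> ball 0 \<rho> \<subseteq> F\<^sub>1 ` ball 0 r\<^sub>1))"
proof -
  note hyp = assms(1)[unfolded landau_hypotheses_def logharmonic_laplacian_def]
  have F: "F z = of_real ((cmod z)\<^sup>2) * L z + K z" if "z \<in> ball 0 1" for z
    using hyp that by blast
  have C1L: "C1_on (ball 0 1) L" and C1K: "C1_on (ball 0 1) K"
    using hyp by (auto simp: logharmonic_on_def harmonic_on_def)
  have LamL: "Lambda_max L z \<le> \<Lambda>\<^sub>2" and LamK: "Lambda_max K z \<le> 1" if "z \<in> ball 0 1" for z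
    using hyp that by auto
  obtain h g where hg: "h holomorphic_on ball 0 1" "g holomorphic_on ball 0 1"
    "\<And>z. z \<in> ball 0 1 \<Longrightarrow> K z = h z + cnj (g z)"
    using hyp by metis
  have "0 \<le> Lambda_max L 0" by (simp add: Lambda_max_def)
  with LamL[of 0] have M: "0 \<le> \<Lambda>\<^sub>2" by simp
  have "lambda_min F 0 = lambda_min K 0"
    by (rule lambda_min_add_norm_square_mult[OF F]) (use C1L C1K in \<open>auto simp: C1_on_def\<close>)
  moreover have "lambda_min F 0 = 1" using hyp by linarith
  ultimately have "lambda_min K 0 = 1" by simp
  moreover have "K 0 = 0" using F[of 0] hyp by simp
  ultimately obtain T where T: "orthogonal_transformation T"
    and KT: "\<And>z. z \<in> ball 0 1 \<Longrightarrow> K z = T z"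
    using harmonic_isometry_of_extremal[OF hg LamK] by metis
  define r\<^sub>1 where "r\<^sub>1 = (if 3 * \<Lambda>\<^sub>2 \<le> 1 then 1 else 1 / sqrt (3 * \<Lambda>\<^sub>2))"
  have r0: "0 < r\<^sub>1" and r1: "r\<^sub>1 \<le> 1" by (auto simp: r\<^sub>1_def)
  \<comment> \<open>Both cases of the radius enter the estimates through this single inequality,
    which is an equality when \<open>3 * \<Lambda>\<^sub>2 > 1\<close>.\<close>
  have Mr: "3 * \<Lambda>\<^sub>2 * r\<^sub>1\<^sup>2 \<le> 1" by (auto simp: r\<^sub>1_def power_divide)
  have sub: "z \<in> ball 0 1" if "z \<in> ball 0 r\<^sub>1" for z :: complex
    using that r1 by simp
  have lip: "cmod (L x - L y) \<le> \<Lambda>\<^sub>2 * cmod (x - y)" if "x \<in> ball 0 r\<^sub>1" "y \<in> ball 0 r\<^sub>1" for x y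
    using lipschitz_of_Lambda_max_le[OF convex_ball C1L LamL] that sub by blast
  \<comment> \<open>The normalization \<open>L 0 = 0\<close> turns the Lipschitz bound, taken
    against the origin, into a growth bound.\<close>
  have bound: "cmod (L x) \<le> \<Lambda>\<^sub>2 * cmod x" if "x \<in> ball 0 r\<^sub>1" for x
    using lip[OF that, of 0] r0 assms(2) by simp
  have F_eq: "(cmod z)\<^sup>2 *\<^sub>R L z + T z = F z" if "z \<in> ball 0 r\<^sub>1" for z
    using F[OF sub[OF that]] KT[OF sub[OF that]] by (simp add: scaleR_conv_of_real)
  have inj: "inj_on F (ball 0 r\<^sub>1)"
    by (rule iffD1[OF inj_on_cong[OF F_eq] cubic_perturbation_inj_on[OF T M Mr lip bound]])
  have "ball 0 (r\<^sub>1 - \<Lambda>\<^sub>2 * r\<^sub>1 ^ 3) \<subseteq> (\<lambda>z. (cmod z)\<^sup>2 *\<^sub>R L z + T z) ` ball 0 r\<^sub>1"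
    by (rule cubic_perturbation_covers[OF T M Mr r0 lip bound])
  also have "\<dots> = F ` ball 0 r\<^sub>1"
    by (rule image_cong[OF refl F_eq])
  finally have "ball 0 (r\<^sub>1 - \<Lambda>\<^sub>2 * r\<^sub>1 ^ 3) \<subseteq> F ` ball 0 r\<^sub>1" .
  then have cover: "ball 0 (r\<^sub>1 - r\<^sub>1 ^ 3 * \<Lambda>\<^sub>2) \<subseteq> F ` ball 0 r\<^sub>1"
    by (simp add: mult.commute)
  have "continuous_on (ball 0 1) L" "continuous_on (ball 0 1) K"
    using C1L C1K
    by (auto simp: C1_on_def
        intro!: continuous_at_imp_continuous_on differentiable_imp_continuous_within)
  then have "continuous_on (ball 0 1) (\<lambda>z. of_real ((cmod z)\<^sup>2) * L z + K z)"
    by (intro continuous_intros)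
  then have "continuous_on (ball 0 1) F"
    by (rule continuous_on_eq) (simp add: F)
  then have "continuous_on (ball 0 r\<^sub>1) F"
    by (rule continuous_on_subset) (use sub in blast)
  \<comment> \<open>Strict monotonicity from 0 to the radius shows that the covered disk is
    nonempty, as a schlicht disk must be.\<close>
  moreover have "0 < r\<^sub>1 - r\<^sub>1 ^ 3 * \<Lambda>\<^sub>2"
    using cubic_less[OF M order_refl r0 Mr] by (simp add: mult.commute)
  ultimately have schlicht: "schlicht_in F (ball 0 r\<^sub>1) (ball 0 (r\<^sub>1 - r\<^sub>1 ^ 3 * \<Lambda>\<^sub>2))"
    using inj cover by (intro schlicht_inI) auto
  let ?F = "\<lambda>z. z - complex_of_real \<Lambda>\<^sub>2 * z\<^sup>2 * cnj z"
  have "\<exists>L\<^sub>1 K\<^sub>1. landau_hypotheses \<Lambda>\<^sub>2 ?F L\<^sub>1 K\<^sub>1 \<and> L\<^sub>1 0 = 0"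
    by (intro exI conjI, rule landau_hypotheses_extremal[OF M]) simp
  moreover have "\<not> inj_on ?F (ball 0 r)" if "r\<^sub>1 < r" "r \<le> 1" for r
  proof (rule extremal_not_inj_on[OF _ r0 that(1)])
    \<comment> \<open>A radius \<open>r\<close> above \<open>r\<^sub>1\<close> and at most 1 exists
      only if \<open>r\<^sub>1 < 1\<close>, which excludes the first case and makes
      \<open>r\<^sub>1\<close> the critical point of the real cubic.\<close>
    have "\<not> 3 * \<Lambda>\<^sub>2 \<le> 1" using that by (auto simp: r\<^sub>1_def split: if_splits)
    then show "3 * \<Lambda>\<^sub>2 * r\<^sub>1\<^sup>2 = 1" by (auto simp: r\<^sub>1_def power_divide)
  qed
  moreover have "\<not> ball 0 \<rho> \<subseteq> ?F ` ball 0 r\<^sub>1" if "r\<^sub>1 - r\<^sub>1 ^ 3 * \<Lambda>\<^sub>2 < \<rho>" for \<rho>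
    by (rule extremal_not_covers[OF M r0 Mr]) (use that in \<open>simp add: mult.commute\<close>)
  ultimately show ?thesis
    unfolding Let_def using r0 r1 inj schlicht
    by (intro exI[of _ r\<^sub>1] exI[of _ "r\<^sub>1 - r\<^sub>1 ^ 3 * \<Lambda>\<^sub>2"]) (simp add: r\<^sub>1_def)
qed

end
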